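(* Let $d\ge3$. For all $u\in l^2(\mathbb{Z}^d)$, $$u(0)^2\le\mathrm{K}_d(0)\,\|\nabla u\|^2,$$ where the sharp (smallest possible) constant is $$\mathrm{K}_d(0)=\frac1{(2\pi)^d}\int_{[0,2\pi]^d}\frac{dx_1\cdots dx_d}{4\left(\sin^2\frac{x_1}2+\dots+\sin^2\frac{x_d}2\right)}.$$
   Context: Sequences are real-valued. For $u\in l^2(\mathbb{Z}^d)$, $\mathrm{D}_iu(n)=u(n+e_i)-u(n)$ with $e_i$ the $i$-th unit vector, $\|\cdot\|$ is the $l^2$-norm, and $\|\nabla u\|^2=\sum_{i=1}^d\|\mathrm{D}_iu\|^2$. *)

theory Defs
  imports "HOL-Analysis.Analysis"
begin

type_synonym 'd lattice = "int ^ 'd"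

definition l2 :: "('a \<Rightarrow> real) set" where
  "l2 = {u. (\<lambda>n. (u n)\<^sup>2) summable_on UNIV}"

definition l2_norm :: "('a \<Rightarrow> real) \<Rightarrow> real" where
  "l2_norm u = sqrt (\<Sum>\<^sub>\<infinity>n. (u n)\<^sup>2)"

definition lattice_diff :: "'d::finite \<Rightarrow> ('d lattice \<Rightarrow> real) \<Rightarrow> 'd lattice \<Rightarrow> real" where
  "lattice_diff i u n = u (n + axis i 1) - u n"

definition grad_norm_sq :: "('d::finite lattice \<Rightarrow> real) \<Rightarrow> real" where
  "grad_norm_sq u = (\<Sum>i\<in>UNIV. (l2_norm (lattice_diff i u))\<^sup>2)"

(* The integrand takes the junk value 0 at the corners of the cube, where the denominator vanishes;
   these form a null set. *)
definition K_zero :: "'d::finite itself \<Rightarrow> real" where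
  "K_zero _ = 1 / (2 * pi) ^ CARD('d) *
     (LINT x:cbox 0 (\<chi> i. 2 * pi)|lborel. 1 / (4 * (\<Sum>i\<in>UNIV. (sin ((x :: real ^ 'd) $ i / 2))\<^sup>2)))"

end

theory Submission
  imports Defs
begin

text \<open>
  Let \<open>P\<close> average a function over the \<open>2d\<close> neighbours of a point and put
  \<open>g\<^sub>N = (\<Sum>k<N. P\<^sup>k \<delta>) / 2d\<close>, a truncated Green's function of the lattice Laplacian.
  Summation by parts gives \<open>\<langle>\<nabla>u, \<nabla>g\<^sub>N\<rangle> = u(0) - \<langle>u, P\<^sup>N \<delta>\<rangle>\<close>, hence also \<open>\<parallel>\<nabla>g\<^sub>N\<parallel>\<^sup>2 \<le> g\<^sub>N(0)\<close>. If
  \<open>g\<^sub>N(0)\<close> converges to \<open>K\<close>, then \<open>\<parallel>P\<^sup>N \<delta>\<parallel>\<^sup>2 = P\<^sup>2\<^sup>N \<delta>(0)\<close> tends to 0, so expanding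
  \<open>\<parallel>\<nabla>(u - t g\<^sub>N)\<parallel>\<^sup>2 \<ge> 0\<close> with \<open>t = u(0) / K\<close> yields the inequality with constant \<open>K\<close>, and the test
  functions \<open>g\<^sub>N\<close> show that no smaller constant works.

  On the torus \<open>P\<close> becomes multiplication by the mean \<open>c(x)\<close> of the \<open>cos x\<^sub>i\<close>, and
  \<open>1 - c = \<sigma> / 2d\<close> with \<open>\<sigma>(x) = 4 \<Sum>\<^sub>i sin\<^sup>2 (x\<^sub>i / 2)\<close>, so \<open>g\<^sub>N(0)\<close> is the mean of \<open>(1 - c\<^sup>N) / \<sigma>\<close>,
  which tends to the mean of \<open>1 / \<sigma>\<close> by dominated convergence. For \<open>d \<ge> 3\<close> the function \<open>1 / \<sigma>\<close>
  is integrable because AM-GM bounds it by the product of the \<open>\<bar>sin (x\<^sub>i / 2)\<bar>\<close> to the power \<open>-2/d\<close>,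
  a product of integrable functions of one variable.
\<close>

subsection \<open>The Dirichlet form and truncated Green's functions\<close>

definition l2_inner :: "('a \<Rightarrow> real) \<Rightarrow> ('a \<Rightarrow> real) \<Rightarrow> real" where
  "l2_inner u v = (\<Sum>\<^sub>\<infinity>n. u n * v n)"

lemma l2_mult_summable:
  assumes "u \<in> l2" "v \<in> l2"
  shows "(\<lambda>n. u n * v n) summable_on UNIV"
proof (rule abs_summable_summable, rule abs_summable_product)
  show "(\<lambda>n. norm (u n * u n)) summable_on UNIV" "(\<lambda>n. norm (v n * v n)) summable_on UNIV"
    using assms by (simp_all add: l2_def power2_eq_square)
qed

lemma l2_add:
  assumes "u \<in> l2" "v \<in> l2"
  shows "(\<lambda>n. u n + v n) \<in> l2"
proof -
  have "(\<lambda>n. (u n)\<^sup>2 + (v n)\<^sup>2 + 2 * (u n * v n)) summable_on UNIV"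
    using assms l2_mult_summable[OF assms]
    by (intro summable_on_add summable_on_cmult_right) (auto simp: l2_def)
  then show ?thesis
    by (simp add: l2_def power2_sum mult.assoc)
qed

lemma l2_cmult:
  assumes "u \<in> l2"
  shows "(\<lambda>n. c * u n) \<in> l2"
  using assms by (simp add: l2_def power_mult_distrib summable_on_cmult_right)

lemma l2_diff:
  assumes "u \<in> l2" "v \<in> l2"
  shows "(\<lambda>n. u n - v n) \<in> l2"
  using l2_add[OF assms(1) l2_cmult[OF assms(2), of "-1"]] by simp

lemma l2_zero: "(\<lambda>_. 0) \<in> l2"
  by (simp add: l2_def)

lemma l2_sum:
  assumes "\<And>i. i \<in> I \<Longrightarrow> u i \<in> l2"
  shows "(\<lambda>n. \<Sum>i\<in>I. u i n) \<in> l2"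
  using assms
  by (induction I rule: infinite_finite_induct) (auto simp: l2_zero intro: l2_add)

lemma bij_shift: "bij (\<lambda>n. n + a :: 'a :: group_add)"
  by (rule bij_betw_byWitness[where f' = "\<lambda>n. n - a"]) auto

lemma l2_shift:
  fixes u :: "'a :: group_add \<Rightarrow> real"
  assumes "u \<in> l2"
  shows "(\<lambda>n. u (n + a)) \<in> l2"
  using assms summable_on_reindex_bij_betw[OF bij_shift, of "\<lambda>n. (u n)\<^sup>2" a]
  by (simp add: l2_def)

lemma l2_inner_shift:
  fixes u v :: "'a :: group_add \<Rightarrow> real"
  shows "l2_inner (\<lambda>n. u (n + a)) (\<lambda>n. v (n + a)) = l2_inner u v"
  unfolding l2_inner_def
  by (rule infsum_reindex_bij_betw[OF bij_shift, where f = "\<lambda>n. u n * v n"])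

lemma l2_inner_commute: "l2_inner u v = l2_inner v u"
  by (simp add: l2_inner_def mult.commute)

lemma l2_inner_self_nonneg: "l2_inner u u \<ge> 0"
  by (simp add: l2_inner_def infsum_nonneg)

lemma l2_inner_nonneg:
  assumes "\<And>n. u n \<ge> 0" "\<And>n. v n \<ge> 0"
  shows "l2_inner u v \<ge> 0"
  using assms by (simp add: l2_inner_def infsum_nonneg)

lemma l2_inner_add_right:
  assumes "u \<in> l2" "v \<in> l2" "w \<in> l2"
  shows "l2_inner u (\<lambda>n. v n + w n) = l2_inner u v + l2_inner u w"
  using assms by (simp add: l2_inner_def distrib_left infsum_add l2_mult_summable)

lemma l2_inner_cmult_right: "l2_inner u (\<lambda>n. c * v n) = c * l2_inner u v"
  by (simp add: l2_inner_def mult.left_commute infsum_cmult_right')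

lemma l2_inner_diff_right:
  assumes "u \<in> l2" "v \<in> l2" "w \<in> l2"
  shows "l2_inner u (\<lambda>n. v n - w n) = l2_inner u v - l2_inner u w"
  using l2_inner_add_right[OF assms(1,2) l2_cmult[OF assms(3), of "-1"]]
    l2_inner_cmult_right[of u "-1" w] by simp

lemma l2_inner_diff_left:
  assumes "u \<in> l2" "v \<in> l2" "w \<in> l2"
  shows "l2_inner (\<lambda>n. v n - w n) u = l2_inner v u - l2_inner w u"
  using l2_inner_diff_right[OF assms] by (simp add: l2_inner_commute)

lemma l2_inner_sum_right:
  assumes "u \<in> l2" "\<And>i. i \<in> I \<Longrightarrow> v i \<in> l2"
  shows "l2_inner u (\<lambda>n. \<Sum>i\<in>I. v i n) = (\<Sum>i\<in>I. l2_inner u (v i))"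
  using assms(2)
  by (induction I rule: infinite_finite_induct)
     (simp_all add: l2_inner_add_right assms l2_sum, simp_all add: l2_inner_def)

text \<open>The quadratic polynomial in t on which both Cauchy-Schwarz and the variational argument
  for the Dirichlet form rest.\<close>

lemma l2_inner_diff_cmult_self:
  assumes "u \<in> l2" "v \<in> l2"
  shows "l2_inner (\<lambda>n. u n - t * v n) (\<lambda>n. u n - t * v n) =
    l2_inner u u - 2 * t * l2_inner u v + t\<^sup>2 * l2_inner v v"
  using assms l2_cmult[OF assms(2), of t] l2_diff[OF assms(1) l2_cmult[OF assms(2), of t]]
  by (simp add: l2_inner_diff_right l2_inner_diff_left l2_inner_cmult_right
      l2_inner_commute[of v u] l2_inner_commute[of "\<lambda>n. t * v n" u] l2_inner_commute[of "\<lambda>n. t * v n" v] power2_eq_square algebra_simps)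

lemma l2_inner_cauchy_schwarz:
  assumes "u \<in> l2" "v \<in> l2"
  shows "(l2_inner u v)\<^sup>2 \<le> l2_inner u u * l2_inner v v"
proof -
  define a b c where "a = l2_inner u u" "b = l2_inner u v" "c = l2_inner v v"
  have *: "0 \<le> a - 2 * t * b + t\<^sup>2 * c" for t
    using l2_inner_self_nonneg[of "\<lambda>n. u n - t * v n"] l2_inner_diff_cmult_self[OF assms, of t]
    by (simp add: a_b_c_def)
  have "c \<ge> 0" "a \<ge> 0" by (simp_all add: a_b_c_def l2_inner_self_nonneg)
  have "b\<^sup>2 \<le> a * c"
  proof (cases "c = 0")
    case True
    have "b = 0"
    proof (rule ccontr)
      assume "b \<noteq> 0"
      \<comment> \<open>With c = 0 the bound \<open>*\<close> is affine in t, and this t makes its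
        right side equal to -1.\<close>
      then show False using *[of "(a + 1) / (2 * b)"] True by simp
    qed
    then show ?thesis using True by simp
  next
    case False
    \<comment> \<open>The minimiser of the quadratic in t.\<close>
    then show ?thesis using *[of "b / c"] \<open>c \<ge> 0\<close>
      by (simp add: field_simps power2_eq_square)
  qed
  then show ?thesis by (simp add: a_b_c_def)
qed

section \<open>The point mass, the averaging operator and summation by parts\<close>

definition unit_mass :: "'a::zero \<Rightarrow> real" where
  "unit_mass n = (if n = 0 then 1 else 0)"

lemma has_sum_mult_unit_mass: "((\<lambda>n. u n * unit_mass n) has_sum u 0) UNIV"
  by (rule has_sum_finite_neutralI[where B = "{0}"]) (auto simp: unit_mass_def)

lemma l2_unit_mass: "unit_mass \<in> l2"
proof -
  have "(\<lambda>n. unit_mass n * unit_mass n) summable_on UNIV"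
    using has_sum_mult_unit_mass[of unit_mass] by (auto simp: summable_on_def)
  then show ?thesis by (simp add: l2_def power2_eq_square)
qed

lemma l2_inner_unit_mass: "l2_inner u unit_mass = u 0"
  unfolding l2_inner_def by (rule infsumI[OF has_sum_mult_unit_mass])

text \<open>The operator P of the overview, i.e. the transition operator of simple random walk on
  the lattice.\<close>

definition neighbour_mean :: "('d::finite lattice \<Rightarrow> real) \<Rightarrow> 'd lattice \<Rightarrow> real" where
  "neighbour_mean u n =
     (\<Sum>i\<in>UNIV. u (n + axis i 1) + u (n - axis i 1)) / (2 * real CARD('d))"

lemma l2_neighbour_mean:
  fixes u :: "'d::finite lattice \<Rightarrow> real"
  assumes "u \<in> l2"
  shows "neighbour_mean u \<in> l2"
proof -
  have "(\<lambda>n. \<Sum>i\<in>UNIV. u (n + axis i 1) + u (n + - axis i 1)) \<in> l2"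
    by (intro l2_sum l2_add l2_shift assms)
  from l2_cmult[OF this, of "1 / (2 * real CARD('d))"] show ?thesis
    unfolding neighbour_mean_def[abs_def] by simp
qed

text \<open>The polarised form of \<open>grad_norm_sq\<close>.\<close>

definition dirichlet :: "('d::finite lattice \<Rightarrow> real) \<Rightarrow> ('d lattice \<Rightarrow> real) \<Rightarrow> real" where
  "dirichlet u v = (\<Sum>i\<in>UNIV. l2_inner (lattice_diff i u) (lattice_diff i v))"

lemma grad_norm_sq_eq_dirichlet: "grad_norm_sq u = dirichlet u u"
  unfolding grad_norm_sq_def dirichlet_def l2_norm_def l2_inner_def power2_eq_square[symmetric]
  by (simp add: infsum_nonneg)

lemma dirichlet_self_nonneg: "dirichlet u u \<ge> 0"
  unfolding dirichlet_def by (intro sum_nonneg l2_inner_self_nonneg)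

lemma dirichlet_commute: "dirichlet u v = dirichlet v u"
  by (simp add: dirichlet_def l2_inner_commute)

text \<open>Minus the lattice Laplacian is 2d(1 - P). In each direction, translation invariance of
  the pairing moves the shift from u to v, leaving 2<u,v> minus the pairing of u with the two
  neighbour values of v; the sum over directions collects these into 2d P v.\<close>

lemma dirichlet_by_parts:
  fixes u v :: "'d::finite lattice \<Rightarrow> real"
  assumes u: "u \<in> l2" and v: "v \<in> l2"
  shows "dirichlet u v = 2 * real CARD('d) * (l2_inner u v - l2_inner u (neighbour_mean v))"
proof -
  define d where "d = real CARD('d)"
  have "d > 0" by (simp add: d_def)
  have 1: "l2_inner (lattice_diff i u) (lattice_diff i v) =
      2 * l2_inner u v - l2_inner u (\<lambda>n. v (n + axis i 1) + v (n + - axis i 1))" for i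
  proof -
    let ?e = "axis i 1 :: 'd lattice"
    have "l2_inner (\<lambda>n. u (n + ?e)) v = l2_inner u (\<lambda>n. v (n + - ?e))"
      using l2_inner_shift[of u ?e "\<lambda>n. v (n + - ?e)"] by simp
    then show ?thesis
      unfolding lattice_diff_def[abs_def]
      by (simp add: l2_inner_diff_right l2_inner_diff_left l2_inner_add_right
          u v l2_shift[OF u] l2_shift[OF v] l2_shift[OF v, of "- ?e", simplified] l2_diff l2_inner_shift)
  qed
  have sh: "(\<lambda>n. v (n + axis i 1) + v (n + - axis i 1)) \<in> l2" for i
    by (intro l2_add l2_shift v)
  have "l2_inner u (neighbour_mean v) =
      l2_inner u (\<lambda>n. 1 / (2 * d) * (\<Sum>i\<in>UNIV. v (n + axis i 1) + v (n + - axis i 1)))"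
    unfolding neighbour_mean_def[abs_def] d_def by simp
  also have "\<dots> = 1 / (2 * d) * (\<Sum>i\<in>UNIV. l2_inner u (\<lambda>n. v (n + axis i 1) + v (n + - axis i 1)))"
    by (simp only: l2_inner_cmult_right l2_inner_sum_right[OF u sh])
  finally have "(\<Sum>i\<in>UNIV. l2_inner u (\<lambda>n. v (n + axis i 1) + v (n + - axis i 1))) =
      2 * d * l2_inner u (neighbour_mean v)"
    using \<open>d > 0\<close> by simp
  then show ?thesis
    unfolding dirichlet_def 1 sum_subtractf by (simp add: d_def algebra_simps)
qed

text \<open>In \<open>dirichlet_by_parts\<close> everything except the P term is visibly symmetric
  in u and v, so that term is symmetric too.\<close>

lemma neighbour_mean_self_adjoint:
  fixes u v :: "'d::finite lattice \<Rightarrow> real"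
  assumes "u \<in> l2" "v \<in> l2"
  shows "l2_inner (neighbour_mean u) v = l2_inner u (neighbour_mean v)"
  using dirichlet_by_parts[OF assms] dirichlet_by_parts[OF assms(2,1)]
  by (simp add: dirichlet_commute l2_inner_commute)

section \<open>Random walk kernels and truncated Green's functions\<close>

definition walk :: "nat \<Rightarrow> 'd::finite lattice \<Rightarrow> real" where
  "walk k = (neighbour_mean ^^ k) unit_mass"

lemma walk_0: "walk 0 = unit_mass" and walk_Suc: "walk (Suc k) = neighbour_mean (walk k)"
  by (simp_all add: walk_def)

lemma l2_walk: "walk k \<in> l2"
  by (induction k) (simp_all add: walk_0 walk_Suc l2_unit_mass l2_neighbour_mean)

lemma walk_nonneg: "walk k n \<ge> 0"
  by (induction k arbitrary: n)
     (simp_all add: walk_0 walk_Suc unit_mass_def neighbour_mean_def sum_nonneg)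

text \<open>\<open>walk k n\<close> is the probability that simple random walk from the origin is at
  n after k steps. Self-adjointness moves the factors P across the pairing one by one; for j = k
  this makes the squared norm of \<open>walk k\<close> a return probability.\<close>

lemma l2_inner_walk:
  "l2_inner (walk j) (walk k :: 'd::finite lattice \<Rightarrow> real) = walk (j + k) (0 :: 'd lattice)"
proof (induction j arbitrary: k)
  case 0
  then show ?case by (simp add: walk_0 l2_inner_commute[of unit_mass] l2_inner_unit_mass)
next
  case (Suc j)
  show ?case
    using Suc[of "Suc k"] neighbour_mean_self_adjoint[OF l2_walk l2_walk, where 'd = 'd, of j k] by (simp add: walk_Suc)
qed

text \<open>The expected number of visits to n at times 0 to N - 1; the factor 1/(2d) inverts the
  one in 2d(1 - P).\<close>

definition green :: "nat \<Rightarrow> 'd::finite lattice \<Rightarrow> real" where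
  "green N n = (\<Sum>k<N. walk k n) / (2 * real CARD('d))"

lemma l2_green: "(green N :: 'd::finite lattice \<Rightarrow> real) \<in> l2"
  using l2_cmult[OF l2_sum[of "{..<N}" "walk :: _ \<Rightarrow> 'd lattice \<Rightarrow> real"], of "1 / (2 * real CARD('d))"]
  by (simp add: green_def[abs_def] l2_walk)

lemma green_nonneg: "green N n \<ge> 0"
  by (simp add: green_def sum_nonneg walk_nonneg)

text \<open>Applying 2d(1 - P) to the truncated Neumann series telescopes to the point mass minus
  \<open>walk N\<close>. The induction adds one term of the series at a time.\<close>

lemma dirichlet_green:
  fixes u :: "'d::finite lattice \<Rightarrow> real"
  assumes u: "u \<in> l2"
  shows "dirichlet u (green N) = u 0 - l2_inner u (walk N)"
proof (induction N)
  case 0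
  have "green 0 = (\<lambda>_ :: 'd lattice. 0 :: real)" by (simp add: green_def fun_eq_iff)
  moreover have "dirichlet u (\<lambda>_. 0) = 0"
    by (simp add: dirichlet_def lattice_diff_def[abs_def] l2_inner_def)
  ultimately show ?case by (simp add: walk_0 l2_inner_unit_mass)
next
  case (Suc N)
  define d where "d = real CARD('d)"
  have "d > 0" by (simp add: d_def)
  have eq: "green (Suc N) = (\<lambda>n :: 'd lattice. green N n + 1 / (2 * d) * walk N n :: real)"
    by (simp add: green_def d_def fun_eq_iff add_divide_distrib)
  have nm: "neighbour_mean (green (Suc N)) =
      (\<lambda>n :: 'd lattice. neighbour_mean (green N) n + 1 / (2 * d) * walk (Suc N) n)"
    unfolding eq walk_Suc
    by (simp add: neighbour_mean_def fun_eq_iff sum.distrib sum_distrib_left add_divide_distrib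
        sum_divide_distrib algebra_simps)
  have "dirichlet u (green (Suc N)) = dirichlet u (green N) + (l2_inner u (walk N) - l2_inner u (walk (Suc N)))"
    unfolding dirichlet_by_parts[OF u l2_green] nm unfolding eq
    using \<open>d > 0\<close>
    by (simp add: l2_inner_add_right u l2_green l2_walk l2_cmult[of _ "1 / (2 * d)", simplified]
        l2_neighbour_mean l2_inner_cmult_right[of _ "1 / (2 * d)", simplified] flip: d_def)
       (simp add: field_simps)
  then show ?case using Suc by simp
qed

text \<open>Taking u = \<open>green N\<close> in \<open>dirichlet_green\<close>, the subtracted
  pairing is nonnegative because both kernels are.\<close>

lemma dirichlet_green_self_le:
  "dirichlet (green N) (green N :: 'd::finite lattice \<Rightarrow> real) \<le> green N (0 :: 'd lattice)"
  using dirichlet_green[OF l2_green, where 'd = 'd, of N N]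
    l2_inner_nonneg[of "green N" "walk N :: 'd lattice \<Rightarrow> real", OF green_nonneg walk_nonneg]
  by simp

lemma dirichlet_diff_cmult_self:
  fixes u v :: "'d::finite lattice \<Rightarrow> real"
  assumes "u \<in> l2" "v \<in> l2"
  shows "dirichlet (\<lambda>n. u n - t * v n) (\<lambda>n. u n - t * v n) =
    dirichlet u u - 2 * t * dirichlet u v + t\<^sup>2 * dirichlet v v"
proof -
  have D: "lattice_diff i w \<in> l2" if "w \<in> l2" for i and w :: "'d lattice \<Rightarrow> real"
    unfolding lattice_diff_def[abs_def] by (intro l2_diff l2_shift that)
  have "lattice_diff i (\<lambda>n. u n - t * v n) = (\<lambda>n. lattice_diff i u n - t * lattice_diff i v n)" for i
    by (simp add: lattice_diff_def fun_eq_iff algebra_simps)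
  moreover have "l2_inner (\<lambda>n. a n - t * b n) (\<lambda>n. a n - t * b n) =
      l2_inner a a - 2 * t * l2_inner a b + t\<^sup>2 * l2_inner b b"
    if "a \<in> l2" "b \<in> l2" for a b :: "'d lattice \<Rightarrow> real"
    by (rule l2_inner_diff_cmult_self[OF that])
  ultimately show ?thesis
    by (simp add: dirichlet_def D assms sum.distrib sum_subtractf sum_distrib_left)
qed

text \<open>The lattice half of the proof. Its analytic input is transience of the walk, i.e.
  convergence of the Green's function at the origin; Fourier analysis later identifies the limit
  K.\<close>

lemma sharp_hardy_of_green:
  fixes K :: real
  assumes K: "(\<lambda>N. green N (0 :: 'd::finite lattice)) \<longlonglongrightarrow> K"
  shows "(\<forall>u \<in> l2. (u (0 :: 'd lattice))\<^sup>2 \<le> K * grad_norm_sq u) \<and>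
         (\<forall>C. (\<forall>u \<in> l2. (u (0 :: 'd lattice))\<^sup>2 \<le> C * grad_norm_sq u) \<longrightarrow> K \<le> C)"
proof (intro conjI ballI allI impI)
  define d where "d = real CARD('d)"
  have "d > 0" by (simp add: d_def)
  have green1: "green 1 (0 :: 'd lattice) = 1 / (2 * d)"
    by (simp add: green_def walk_0 unit_mass_def d_def)
  have inc: "incseq (\<lambda>N. green N (0 :: 'd lattice))"
    by (intro incseq_SucI) (simp add: green_def divide_right_mono walk_nonneg)
  have le_K: "green N (0 :: 'd lattice) \<le> K" for N
    by (rule incseq_le[OF inc K])
  have "K > 0" using le_K[of 1] green1 \<open>d > 0\<close> by (smt (verit) divide_pos_pos)
  \<comment> \<open>The increments of a convergent sequence vanish in the limit, and these
    increments are the return probabilities up to the factor 2d.\<close>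
  have "(\<lambda>N. 2 * d * (green (Suc N) (0 :: 'd lattice) - green N (0 :: 'd lattice))) \<longlonglongrightarrow> 2 * d * (K - K)"
    by (intro tendsto_mult tendsto_diff tendsto_const K LIMSEQ_Suc[OF K])
  moreover have "2 * d * (green (Suc N) (0 :: 'd lattice) - green N (0 :: 'd lattice)) = walk N (0 :: 'd lattice)" for N
    using \<open>d > 0\<close> by (simp add: green_def d_def field_simps)
  ultimately have walk_lim: "(\<lambda>N. walk N (0 :: 'd lattice)) \<longlonglongrightarrow> 0" by simp

  fix u :: "'d lattice \<Rightarrow> real"
  assume u: "u \<in> l2"
  have "(\<lambda>N. walk (2 * N) (0 :: 'd lattice)) \<longlonglongrightarrow> 0"
    using LIMSEQ_subseq_LIMSEQ[OF walk_lim, of "\<lambda>N. 2 * N"] by (simp add: strict_mono_def o_def)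
  then have "(\<lambda>N. sqrt (l2_inner u u * walk (2 * N) (0 :: 'd lattice))) \<longlonglongrightarrow> sqrt (l2_inner u u * 0)"
    by (intro tendsto_intros)
  \<comment> \<open>Cauchy-Schwarz, with \<open>walk (2 * N) 0\<close> as the squared norm of
    \<open>walk N\<close>.\<close>
  moreover have "\<bar>l2_inner u (walk N)\<bar> \<le> sqrt (l2_inner u u * walk (2 * N) (0 :: 'd lattice))" for N
    using l2_inner_cauchy_schwarz[OF u l2_walk, of N] real_le_rsqrt[of "\<bar>l2_inner u (walk N)\<bar>"]
    by (simp add: l2_inner_walk mult_2)
  ultimately have ip: "(\<lambda>N. l2_inner u (walk N)) \<longlonglongrightarrow> 0"
    using Lim_null_comparison[of "\<lambda>N. l2_inner u (walk N)"
        "\<lambda>N. sqrt (l2_inner u u * walk (2 * N) (0 :: 'd lattice))" sequentially] by simp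
  \<comment> \<open>The minimiser of the limiting quadratic
    \<open>dirichlet u u - 2 * t * u 0 + t\<^sup>2 * K\<close>, whose minimum is
    \<open>dirichlet u u - (u 0)\<^sup>2 / K\<close>.\<close>
  define t where "t = u 0 / K"
  have "0 \<le> dirichlet u u - 2 * t * (u 0 - l2_inner u (walk N)) + t\<^sup>2 * K" for N
  proof -
    have "0 \<le> dirichlet u u - 2 * t * dirichlet u (green N) +
        t\<^sup>2 * dirichlet (green N) (green N :: 'd lattice \<Rightarrow> real)"
      using dirichlet_diff_cmult_self[OF u l2_green, of t N]
        dirichlet_self_nonneg[of "\<lambda>n. u n - t * green N n"] by simp
    also have "t\<^sup>2 * dirichlet (green N) (green N :: 'd lattice \<Rightarrow> real) \<le> t\<^sup>2 * K"
      by (intro mult_left_mono order_trans[OF dirichlet_green_self_le le_K]) simp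
    finally show ?thesis by (simp add: dirichlet_green[OF u])
  qed
  moreover have "(\<lambda>N. dirichlet u u - 2 * t * (u 0 - l2_inner u (walk N)) + t\<^sup>2 * K)
      \<longlonglongrightarrow> dirichlet u u - 2 * t * (u 0 - 0) + t\<^sup>2 * K"
    by (intro tendsto_intros ip)
  ultimately have "0 \<le> dirichlet u u - 2 * t * (u 0 - 0) + t\<^sup>2 * K"
    by (intro LIMSEQ_le_const) auto
  then show "(u 0)\<^sup>2 \<le> K * grad_norm_sq u"
    using \<open>K > 0\<close> by (simp add: t_def grad_norm_sq_eq_dirichlet field_simps power2_eq_square)
next
  fix C
  assume C: "\<forall>u \<in> l2. (u (0 :: 'd lattice))\<^sup>2 \<le> C * grad_norm_sq u"
  \<comment> \<open>Testing C on the Green's function gives g^2 \<le> C E \<le> C g, and g cancels.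
    The index \<open>Suc N\<close> ensures g > 0, since \<open>green 0\<close> vanishes; the first
    inequality forces C > 0, which the second one uses.\<close>
  have "green (Suc N) (0 :: 'd lattice) \<le> C" for N
  proof -
    define g where "g = green (Suc N) (0 :: 'd lattice)"
    define E where "E = dirichlet (green (Suc N)) (green (Suc N) :: 'd lattice \<Rightarrow> real)"
    have "walk 0 (0 :: 'd lattice) \<le> (\<Sum>k<Suc N. walk k (0 :: 'd lattice))"
      by (rule member_le_sum) (auto simp: walk_nonneg)
    then have "g \<ge> 1 / (2 * real CARD('d))"
      unfolding g_def green_def by (intro divide_right_mono) (simp_all add: walk_0 unit_mass_def)
    then have "g > 0" by (smt (verit) divide_pos_pos of_nat_0_less_iff zero_less_card_finite)
    have "g\<^sup>2 \<le> C * E"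
      using C l2_green by (auto simp: g_def E_def grad_norm_sq_eq_dirichlet)
    moreover have "E \<ge> 0" "E \<le> g"
      by (simp_all add: E_def g_def dirichlet_self_nonneg dirichlet_green_self_le)
    moreover have "C > 0"
      using \<open>g > 0\<close> \<open>E \<ge> 0\<close> \<open>g\<^sup>2 \<le> C * E\<close>
      by (smt (verit) mult_nonpos_nonneg zero_less_power)
    ultimately have "g * g \<le> C * g"
      by (smt (verit) mult_left_mono power2_eq_square)
    then show ?thesis using \<open>g > 0\<close> by (simp add: g_def)
  qed
  then show "K \<le> C"
    by (intro LIMSEQ_le_const2[OF LIMSEQ_Suc[OF K]]) auto
qed

subsection \<open>Fourier representation of the walk kernel\<close>

text \<open>Fubini for products of one-variable functions. \<open>lborel_eq\<close> presents
  Lebesgue measure as the image of a product measure indexed by \<open>Basis\<close>, so the work is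
  to rename coordinates as basis vectors through \<open>e\<close>. The field \<open>'b\<close> is
  general so as to cover complex characters as well as real majorants.\<close>

lemma lborel_vec_prod:
  fixes h :: "'n::finite \<Rightarrow> real \<Rightarrow> 'b::{real_normed_field,banach,second_countable_topology}"
  assumes h: "\<And>i. integrable lborel (h i)"
  shows integrable_lborel_vec_prod: "integrable lborel (\<lambda>x::real^'n. \<Prod>i\<in>UNIV. h i (x $ i))"
    and integral_lborel_vec_prod:
      "(LINT x|lborel. (\<Prod>i\<in>UNIV. h i ((x::real^'n) $ i))) = (\<Prod>i\<in>UNIV. (LINT t|lborel. h i t))"
proof -
  interpret product_sigma_finite "\<lambda>_ :: real^'n. lborel :: real measure" ..
  define e where "e = (\<lambda>i::'n. axis i (1::real))"
  define h' where "h' b = h (inv e b)" for b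
  define F where "F = (\<lambda>f :: real^'n \<Rightarrow> real. \<Sum>b\<in>Basis. f b *\<^sub>R b)"
  let ?P = "\<Pi>\<^sub>M b\<in>(Basis :: (real^'n) set). (lborel :: real measure)"
  have e: "bij_betw e UNIV Basis"
    by (auto simp: bij_betw_def e_def Basis_vec_def inj_on_def axis_eq_axis)
  have h'_e: "h' (e i) = h i" for i
    using e by (simp add: h'_def bij_betw_def)
  have F_nth: "F f $ i = f (e i)" for f i
  proof -
    have "F f = (\<Sum>j\<in>UNIV. f (e j) *\<^sub>R e j)"
      unfolding F_def by (rule sum.reindex_bij_betw[OF e, symmetric])
    then show ?thesis
      by (simp add: e_def axis_def if_distrib sum.delta' cong: if_cong)
  qed
  have reindex: "(\<Prod>i\<in>UNIV. h i (F f $ i)) = (\<Prod>b\<in>Basis. h' b (f b))" for f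
    using prod.reindex_bij_betw[OF e, of "\<lambda>b. h' b (f b)"] by (simp add: F_nth h'_e)
  have meas: "F \<in> ?P \<rightarrow>\<^sub>M borel"
    unfolding F_def by measurable
  have "h i \<in> borel_measurable borel" for i
    using borel_measurable_integrable[OF h] by simp
  then have meas2: "(\<lambda>x::real^'n. \<Prod>i\<in>UNIV. h i (x $ i)) \<in> borel_measurable borel"
    by measurable
  have int: "integrable lborel (h' b)" for b by (simp add: h'_def h)
  have lb: "lborel = distr ?P borel F"
    unfolding F_def by (rule lborel_eq)
  show "integrable lborel (\<lambda>x::real^'n. \<Prod>i\<in>UNIV. h i (x $ i))"
    unfolding lb integrable_distr_eq[OF meas meas2] reindex
    by (rule product_integrable_prod) (auto simp: int)
  show "(LINT x|lborel. (\<Prod>i\<in>UNIV. h i ((x::real^'n) $ i))) = (\<Prod>i\<in>UNIV. (LINT t|lborel. h i t))"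
    unfolding lb integral_distr[OF meas meas2] reindex
    by (subst product_integral_prod)
       (auto simp: int h'_e prod.reindex_bij_betw[OF e, symmetric])
qed

section \<open>Trigonometric integrals over the torus\<close>

abbreviation torus_cube :: "(real ^ 'd) set" where
  "torus_cube \<equiv> cbox 0 (\<chi> i. 2 * pi)"

text \<open>Brings integrals over the cube into the product form of
  \<open>lborel_vec_prod\<close>.\<close>

lemma indicator_torus_cube:
  "indicator torus_cube (x :: real ^ 'd::finite) = (\<Prod>i\<in>UNIV. indicator {0..2 * pi} (x $ i) :: 'a :: {comm_semiring_1})"
proof (cases "x \<in> torus_cube")
  case True
  then show ?thesis by (auto simp: mem_box_cart)
next
  case False
  then obtain i where "x $ i \<notin> {0..2 * pi}" by (auto simp: mem_box_cart)
  then have "(\<Prod>i\<in>UNIV. indicator {0..2 * pi} (x $ i) :: 'a) = 0"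
    by (intro prod_zero) (auto simp: indicator_def)
  then show ?thesis using False by simp
qed

definition phase :: "'d::finite lattice \<Rightarrow> real ^ 'd \<Rightarrow> real" where
  "phase n x = (\<Sum>i\<in>UNIV. of_int (n $ i) * x $ i)"

lemma integral_cis_period:
  fixes m :: int
  shows "integrable lborel (\<lambda>t. indicator {0..2 * pi} t *\<^sub>R cis (of_int m * t))"
    and "(LINT t|lborel. indicator {0..2 * pi} t *\<^sub>R cis (of_int m * t)) = (if m = 0 then 2 * pi else 0)"
proof -
  show "integrable lborel (\<lambda>t. indicator {0..2 * pi} t *\<^sub>R cis (of_int m * t))"
    by (intro borel_integrable_compact continuous_intros) auto
  show "(LINT t|lborel. indicator {0..2 * pi} t *\<^sub>R cis (of_int m * t)) = (if m = 0 then 2 * pi else 0)"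
  proof (cases "m = 0")
    case True
    then show ?thesis by (simp add: scaleR_conv_of_real)
  next
    case False
    have "(LINT t|lborel. indicator {0..2 * pi} t *\<^sub>R cis (of_int m * t)) =
        cis (of_int m * (2 * pi)) / (\<i> * of_int m) - cis (of_int m * 0) / (\<i> * of_int m)"
    proof (rule integral_FTC_atLeastAtMost)
      fix t :: real
      show "((\<lambda>t. cis (of_int m * t) / (\<i> * of_int m)) has_vector_derivative cis (of_int m * t)) (at t within {0..2 * pi})"
        using False unfolding cis_conv_exp
        by (auto intro!: derivative_eq_intros has_vector_derivative_real_field simp: field_simps)
    qed (auto intro!: continuous_intros)
    also have "cis (of_int m * (2 * pi)) = 1"
      using cis_multiple_2pi[of "of_int m"] by (simp add: mult_ac)
    finally show ?thesis using False by simp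
  qed
qed

text \<open>Orthogonality of characters. The cosine of a sum does not factor over the coordinates
  but \<open>cis\<close> does, so the integral is computed as the real part of a product of
  one-dimensional complex integrals.\<close>

lemma integral_cos_phase:
  "(LINT x|lborel. indicator torus_cube x * cos (phase n x)) =
     (2 * pi) ^ CARD('d) * unit_mass (n :: 'd::finite lattice)"
proof -
  define h where "h i = (\<lambda>t. indicator {0..2 * pi} t *\<^sub>R cis (of_int (n $ i) * t))" for i
  have h: "integrable lborel (h i)" for i
    unfolding h_def by (rule integral_cis_period)
  have eq: "(\<Prod>i\<in>UNIV. h i (x $ i)) = indicator torus_cube x *\<^sub>R cis (phase n x)" for x :: "real ^ 'd"
  proof -
    have "cis (phase n x) = (\<Prod>i\<in>UNIV. cis (of_int (n $ i) * x $ i))"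
      by (simp add: phase_def cis_conv_exp exp_sum sum_distrib_left)
    then show ?thesis
      by (simp add: h_def scaleR_conv_of_real indicator_torus_cube prod.distrib)
  qed
  have int: "integrable lborel (\<lambda>x :: real ^ 'd. indicator torus_cube x *\<^sub>R cis (phase n x))"
    using integrable_lborel_vec_prod[of h, OF h] by (simp add: eq)
  have "(LINT x|lborel. indicator torus_cube x * cos (phase n x)) =
      (LINT x|lborel. Re (indicator torus_cube x *\<^sub>R cis (phase n x)))"
    by simp
  also have "\<dots> = Re (LINT x|lborel. indicator torus_cube x *\<^sub>R cis (phase n x))"
    by (rule integral_Re[OF int])
  also have "(LINT x|lborel. indicator torus_cube x *\<^sub>R cis (phase n x)) =
      (\<Prod>i\<in>UNIV. (LINT t|lborel. h i t))"
    using integral_lborel_vec_prod[of h, OF h] by (simp add: eq)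
  also have "\<dots> = (\<Prod>i\<in>UNIV. complex_of_real (if n $ i = 0 then 2 * pi else 0))"
    by (simp add: h_def integral_cis_period)
  also have "Re \<dots> = (2 * pi) ^ CARD('d) * unit_mass n"
  proof (cases "n = 0")
    case True
    then show ?thesis by (simp add: unit_mass_def flip: of_real_power of_real_mult)
  next
    case False
    then obtain i where "n $ i \<noteq> 0" by (auto simp: vec_eq_iff)
    then have zero: "(\<Prod>i\<in>UNIV. complex_of_real (if n $ i = 0 then 2 * pi else 0)) = 0"
      by (intro prod_zero) auto
    show ?thesis unfolding zero using False by (simp add: unit_mass_def)
  qed
  finally show ?thesis .
qed

text \<open>The Fourier multiplier of \<open>neighbour_mean\<close>, written c in the
  overview.\<close>

definition cos_mean :: "real ^ 'd::finite \<Rightarrow> real" where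
  "cos_mean x = (\<Sum>i\<in>UNIV. cos (x $ i)) / real CARD('d)"

lemma integrable_torus_cube:
  fixes f :: "real ^ 'd::finite \<Rightarrow> real"
  assumes "continuous_on UNIV f"
  shows "integrable lborel (\<lambda>x. indicator torus_cube x * f x)"
  using borel_integrable_compact[OF compact_cbox continuous_on_subset[OF assms subset_UNIV]]
  by simp

lemma continuous_cos_mean: "continuous_on UNIV (cos_mean :: real ^ 'd::finite \<Rightarrow> real)"
  unfolding cos_mean_def[abs_def] by (intro continuous_intros) auto

lemma continuous_phase: "continuous_on UNIV (phase n)"
  unfolding phase_def[abs_def] by (intro continuous_intros)

text \<open>Since cos(a + b) + cos(a - b) = 2 cos a cos b, averaging the integrand over the
  neighbours of n multiplies it by \<open>cos_mean x\<close>. The induction therefore needs all n at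
  once.\<close>

lemma walk_eq_integral:
  "(LINT x|lborel. indicator torus_cube x * (cos (phase n x) * cos_mean x ^ k)) =
     (2 * pi) ^ CARD('d) * walk k (n :: 'd::finite lattice)"
proof (induction k arbitrary: n)
  case 0
  then show ?case by (simp add: integral_cos_phase walk_0)
next
  case (Suc k)
  let ?I = "\<lambda>n x. indicator torus_cube x * (cos (phase n x) * cos_mean x ^ k)"
  have phase: "phase (n + axis i 1) x = phase n x + x $ i" "phase (n - axis i 1) x = phase n x - x $ i"
    for i :: 'd and x
  proof -
    have "phase (axis i 1) x = (\<Sum>j\<in>UNIV. if j = i then x $ j else 0)"
      unfolding phase_def by (intro sum.cong) (auto simp: axis_def)
    then have "phase (axis i 1) x = x $ i" by simp
    then show "phase (n + axis i 1) x = phase n x + x $ i" "phase (n - axis i 1) x = phase n x - x $ i"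
      by (simp_all add: phase_def distrib_right left_diff_distrib sum.distrib sum_subtractf)
  qed
  have "(LINT x|lborel. indicator torus_cube x * (cos (phase n x) * cos_mean x ^ Suc k)) =
     (LINT x|lborel. (\<Sum>i\<in>UNIV. ?I (n + axis i 1) x + ?I (n - axis i 1) x) / (2 * real CARD('d)))"
  proof (intro Bochner_Integration.integral_cong refl)
    fix x :: "real ^ 'd"
    have "?I (n + axis i 1) x + ?I (n - axis i 1) x =
        2 * (indicator torus_cube x * (cos (phase n x) * cos_mean x ^ k)) * cos (x $ i)" for i
      by (simp add: phase cos_add cos_diff algebra_simps)
    then show "indicator torus_cube x * (cos (phase n x) * cos_mean x ^ Suc k) =
        (\<Sum>i\<in>UNIV. ?I (n + axis i 1) x + ?I (n - axis i 1) x) / (2 * real CARD('d))"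
      by (simp add: cos_mean_def flip: sum_distrib_left)
  qed
  also have "\<dots> = (\<Sum>i\<in>UNIV. (LINT x|lborel. ?I (n + axis i 1) x) + (LINT x|lborel. ?I (n - axis i 1) x))
      / (2 * real CARD('d))"
  proof -
    have int: "integrable lborel (?I m)" for m
      by (intro integrable_torus_cube continuous_intros continuous_cos_mean continuous_phase)
    have "(LINT x|lborel. (\<Sum>i\<in>UNIV. ?I (n + axis i 1) x + ?I (n - axis i 1) x)) =
        (\<Sum>i\<in>UNIV. (LINT x|lborel. ?I (n + axis i 1) x) + (LINT x|lborel. ?I (n - axis i 1) x))"
      by (simp only: Bochner_Integration.integral_sum Bochner_Integration.integral_add
          Bochner_Integration.integrable_add int)
    then show ?thesis by simp
  qed
  also have "\<dots> = (2 * pi) ^ CARD('d) * walk (Suc k) n"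
    unfolding Suc walk_Suc neighbour_mean_def by (simp add: sum_distrib_left distrib_left)
  finally show ?case .
qed

subsection \<open>Integrability of the inverse symbol\<close>

lemma integrable_powr_interval:
  fixes a c :: real
  assumes "a > -1" "c \<ge> 0"
  shows "integrable lborel (\<lambda>t. indicator {0..c} t * t powr a)"
proof -
  have "(\<lambda>t. t powr a) absolutely_integrable_on {0..c}"
    using has_integral_powr_from_0[OF assms]
    by (intro nonnegative_absolutely_integrable_1) (auto simp: integrable_on_def)
  then have "integrable lebesgue (\<lambda>t. indicator {0..c} t * t powr a)"
    by (simp add: set_integrable_def)
  then show ?thesis
    by (subst (asm) integrable_completion) measurable
qed

text \<open>Jordan's inequality: the sine is concave on [0, pi/2] and so lies above its
  chord.\<close>

lemma sin_half_lower_bound: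
  assumes "0 \<le> t" "t \<le> pi"
  shows "t / pi \<le> sin (t / 2)"
proof -
  have "concave_on {0..pi / 2} sin"
    by (rule f''_le0_imp_concave[where f' = cos and f'' = "\<lambda>x. - sin x"])
       (auto intro!: derivative_eq_intros sin_ge_zero)
  from concave_onD_Icc'[OF this, of "t / 2"] show ?thesis
    using assms by (simp add: field_simps)
qed

text \<open>Near each of the singular endpoints 0 and 2 pi the integrand is at most a constant times
  the distance to the power -2b, and 2b < 1.\<close>

lemma integrable_sin_half_powr:
  assumes "0 < b" "b < 1 / 2"
  shows "integrable lborel (\<lambda>t. indicator {0..2 * pi} t * ((sin (t / 2))\<^sup>2) powr (- b))"
proof (rule Bochner_Integration.integrable_bound)
  define g where "g t = indicator {0..2 * pi} t * t powr (- (2 * b))" for t :: real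
  have g: "integrable lborel g"
    unfolding g_def using assms by (intro integrable_powr_interval) auto
  \<comment> \<open>The reflection of g takes care of the singularity at 2 pi.\<close>
  have "integrable lborel (\<lambda>t. g (2 * pi + (- 1) * t))"
    by (rule lborel_integrable_real_affine[OF g]) simp
  with g show "integrable lborel (\<lambda>t. pi powr (2 * b) * (g t + g (2 * pi - t)))"
    by simp
  have g_nonneg: "0 \<le> g t" for t by (simp add: g_def)
  have bound: "((sin (t / 2))\<^sup>2) powr (- b) \<le> pi powr (2 * b) * g t" if "0 \<le> t" "t \<le> pi" for t
  \<comment> \<open>At t = 0 the convention \<open>0 powr a = 0\<close> makes the left side
    0.\<close>
  proof (cases "t = 0")
    case False
    then have "0 < t / pi" using that by simp
    have le: "(t / pi)\<^sup>2 \<le> (sin (t / 2))\<^sup>2"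
      using sin_half_lower_bound[OF that] \<open>0 < t / pi\<close> by (intro power_mono) auto
    have "((sin (t / 2))\<^sup>2) powr (- b) \<le> ((t / pi)\<^sup>2) powr (- b)"
      using assms le \<open>0 < t / pi\<close> by (intro powr_mono2') auto
    also have "\<dots> = (t / pi) powr (- (2 * b))"
      using \<open>0 < t / pi\<close> by (simp add: powr_powr flip: powr_numeral)
    also have "\<dots> = pi powr (2 * b) * g t"
      using that False by (simp add: g_def powr_divide powr_minus field_simps)
    finally show ?thesis .
  qed (simp add: g_nonneg)
  show "AE t in lborel. norm (indicator {0..2 * pi} t * ((sin (t / 2))\<^sup>2) powr (- b))
      \<le> norm (pi powr (2 * b) * (g t + g (2 * pi - t)))"
  proof (rule AE_I2)
    fix t :: real
    have "((sin (t / 2))\<^sup>2) powr (- b) \<le> pi powr (2 * b) * (g t + g (2 * pi - t))"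
      if t: "0 \<le> t" "t \<le> 2 * pi"
    proof (cases "t \<le> pi")
      case True
      from bound[OF t(1) True] g_nonneg[of "2 * pi - t"] show ?thesis
        by (smt (verit) mult_left_mono powr_ge_zero)
    next
      case False
      have "sin ((2 * pi - t) / 2) = sin (t / 2)"
        by (simp add: diff_divide_distrib)
      with bound[of "2 * pi - t"] False t g_nonneg[of t] show ?thesis
        by (smt (verit) mult_left_mono powr_ge_zero)
    qed
    then show "norm (indicator {0..2 * pi} t * ((sin (t / 2))\<^sup>2) powr (- b))
      \<le> norm (pi powr (2 * b) * (g t + g (2 * pi - t)))"
      using g_nonneg by (auto simp: indicator_def)
  qed
qed measurable

text \<open>The exceptional points lie on countably many hyperplanes. Discarding them removes both
  the zeros of the symbol, where 1/0 occurs, and the points with \<open>cos_mean x = -1\<close>,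
  where the powers oscillate.\<close>

lemma AE_sin_nonzero: "AE x in lborel. \<forall>i. sin ((x :: real ^ 'd::finite) $ i) \<noteq> 0"
proof -
  have "AE x in lborel. \<forall>k::int. (x :: real ^ 'd) $ i \<noteq> of_int k * pi" for i
  proof (subst AE_all_countable, rule allI)
    fix k :: int
    have "negligible {x :: real ^ 'd. x \<bullet> axis i 1 = of_int k * pi}"
      by (intro negligible_standard_hyperplane) (auto simp: Basis_vec_def)
    then have "AE x in lebesgue. (x :: real ^ 'd) $ i \<noteq> of_int k * pi"
      by (simp add: negligible_iff_null_sets inner_axis eventually_ae_filter)
         (auto intro!: exI)
    then show "AE x in lborel. (x :: real ^ 'd) $ i \<noteq> of_int k * pi"
      by (simp add: AE_completion_iff)
  qed
  then have "AE x in lborel. \<forall>i. \<forall>k::int. (x :: real ^ 'd) $ i \<noteq> of_int k * pi"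
    by (subst AE_all_countable) blast
  then show ?thesis by (simp add: sin_zero_iff_int2)
qed

section \<open>The Fourier symbol of minus the lattice Laplacian\<close>

definition symbol :: "real ^ 'd::finite \<Rightarrow> real" where
  "symbol x = 4 * (\<Sum>i\<in>UNIV. (sin (x $ i / 2))\<^sup>2)"

lemma one_minus_cos_mean:
  "1 - cos_mean x = symbol x / (2 * real CARD('d))" for x :: "real ^ 'd::finite"
proof -
  have "cos (x $ i) = 1 - 2 * (sin (x $ i / 2))\<^sup>2" for i
    using cos_double_sin[of "x $ i / 2"] by simp
  then have "(\<Sum>i\<in>UNIV. cos (x $ i)) = real CARD('d) - 2 * (\<Sum>i\<in>UNIV. (sin (x $ i / 2))\<^sup>2)"
    by (simp only: sum_subtractf sum_distrib_left) simp
  then show ?thesis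
    by (simp add: cos_mean_def symbol_def field_simps)
qed

lemma symbol_nonneg: "symbol x \<ge> 0"
  by (simp add: symbol_def sum_nonneg)

lemma abs_cos_mean_le_1: "\<bar>cos_mean x\<bar> \<le> 1"
proof -
  have "\<bar>\<Sum>i\<in>UNIV. cos (x $ i)\<bar> \<le> (\<Sum>i\<in>(UNIV :: 'a set). 1)"
    by (rule order_trans[OF sum_abs sum_mono]) simp
  then show ?thesis by (simp add: cos_mean_def)
qed

lemma abs_cos_mean_less_1:
  fixes x :: "real ^ 'd::finite"
  assumes "\<And>i. sin (x $ i) \<noteq> 0"
  shows "\<bar>cos_mean x\<bar> < 1"
proof -
  have "\<bar>cos (x $ i)\<bar> < 1" for i
  proof -
    have "(cos (x $ i))\<^sup>2 < 1"
      using assms[of i] sin_cos_squared_add[of "x $ i"] by (smt (verit) zero_less_power2)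
    then show ?thesis by (simp add: abs_square_less_1)
  qed
  then have "\<bar>\<Sum>i\<in>UNIV. cos (x $ i)\<bar> < (\<Sum>i\<in>(UNIV :: 'd set). 1)"
    by (intro order.strict_trans1[OF sum_abs sum_strict_mono]) auto
  then show ?thesis by (simp add: cos_mean_def)
qed

lemma measurable_symbol [measurable]: "symbol \<in> borel_measurable borel"
  unfolding symbol_def[abs_def] by measurable

lemma inverse_symbol_le:
  fixes x :: "real ^ 'd::finite"
  assumes "\<And>i. sin (x $ i / 2) \<noteq> 0"
  shows "1 / symbol x \<le> (\<Prod>i\<in>UNIV. ((sin (x $ i / 2))\<^sup>2) powr (- (1 / real CARD('d))))"
proof -
  let ?d = "real CARD('d)"
  define s where "s i = (sin (x $ i / 2))\<^sup>2" for i
  have s: "s i > 0" for i using assms[of i] by (simp add: s_def)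
  have "(\<Prod>i\<in>UNIV. s i) powr (1 / ?d) \<le> (\<Sum>i\<in>UNIV. s i / ?d)"
    by (rule arith_geom_mean) (auto simp: s_def)
  also have "\<dots> = (\<Sum>i\<in>UNIV. s i) / ?d" by (simp add: sum_divide_distrib)
  \<comment> \<open>The constant is irrelevant to integrability, so 1/d is relaxed to the 4 of the
    symbol.\<close>
  also have "\<dots> \<le> 4 * (\<Sum>i\<in>UNIV. s i)"
  proof -
    have S: "0 \<le> (\<Sum>i\<in>UNIV. s i)" by (simp add: s_def sum_nonneg)
    have "CARD('d) \<ge> 1" by (simp add: Suc_leI)
    then have "?d \<ge> 1" by linarith
    then have "(\<Sum>i\<in>UNIV. s i) / ?d \<le> (\<Sum>i\<in>UNIV. s i) / 1"
      by (intro divide_left_mono S) auto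
    with S show ?thesis by linarith
  qed
  also have "\<dots> = symbol x" by (simp add: symbol_def s_def)
  finally have le: "(\<Prod>i\<in>UNIV. s i) powr (1 / ?d) \<le> symbol x" .
  have "(\<Prod>i\<in>UNIV. s i) > 0" by (simp add: prod_pos s)
  then have "(\<Prod>i\<in>UNIV. s i) powr (1 / ?d) > 0" by (simp only: powr_gt_zero)
  with le have "1 / symbol x \<le> 1 / (\<Prod>i\<in>UNIV. s i) powr (1 / ?d)"
    by (intro divide_left_mono mult_pos_pos) linarith+
  also have "\<dots> = (\<Prod>i\<in>UNIV. s i powr (- (1 / ?d)))"
    using s by (simp add: powr_minus_divide prod_powr_distrib less_imp_le prod_dividef)
  finally show ?thesis by (simp add: s_def)
qed

lemma integrable_inverse_symbol:
  assumes "CARD('d::finite) \<ge> 3"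
  shows "integrable lborel (\<lambda>x :: real ^ 'd. indicator torus_cube x * (1 / symbol x))"
proof (rule Bochner_Integration.integrable_bound)
  define h where "h t = indicator {0..2 * pi} t * ((sin (t / 2))\<^sup>2) powr (- (1 / real CARD('d)))" for t
  \<comment> \<open>Here d \<ge> 3 enters: the one-variable factors are sines to the power -2/d,
    integrable because 2/d < 1.\<close>
  have "1 / real CARD('d) < 1 / 2" using assms by (simp add: field_simps)
  then have "integrable lborel h"
    unfolding h_def by (intro integrable_sin_half_powr) auto
  then show "integrable lborel (\<lambda>x :: real ^ 'd. \<Prod>i\<in>UNIV. h (x $ i))"
    by (rule integrable_lborel_vec_prod)
  show "AE x :: real ^ 'd in lborel. norm (indicator torus_cube x * (1 / symbol x)) \<le> norm (\<Prod>i\<in>UNIV. h (x $ i))"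
    using AE_sin_nonzero[where 'd = 'd]
  proof eventually_elim
    case (elim x)
    have "sin (x $ i / 2) \<noteq> 0" for i
      using elim sin_double[of "x $ i / 2"] by auto
    then have "1 / symbol x \<le> (\<Prod>i\<in>UNIV. ((sin (x $ i / 2))\<^sup>2) powr (- (1 / real CARD('d))))"
      by (rule inverse_symbol_le)
    moreover have "(\<Prod>i\<in>UNIV. h (x $ i)) = indicator torus_cube x *
        (\<Prod>i\<in>UNIV. ((sin (x $ i / 2))\<^sup>2) powr (- (1 / real CARD('d))))"
      by (simp add: h_def prod.distrib indicator_torus_cube)
    moreover have "0 \<le> 1 / symbol x" by (simp add: symbol_nonneg)
    ultimately show ?case by (auto simp: indicator_def abs_mult)
  qed
qed measurable

section \<open>The Green's function at the origin as a torus integral, and its limit\<close>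

lemma green_eq_integral:
  "green N (0 :: 'd::finite lattice) = 1 / (2 * pi) ^ CARD('d) *
    (LINT x|lborel. indicator torus_cube (x :: real ^ 'd) * ((\<Sum>k<N. cos_mean x ^ k) / (2 * real CARD('d))))"
proof -
  have "integrable lborel (\<lambda>x :: real ^ 'd. indicator torus_cube x * cos_mean x ^ k)" for k
    by (intro integrable_torus_cube continuous_intros continuous_cos_mean)
  moreover have "(LINT x|lborel. indicator torus_cube (x :: real ^ 'd) * cos_mean x ^ k) =
      (2 * pi) ^ CARD('d) * walk k (0 :: 'd lattice)" for k
    using walk_eq_integral[of "0 :: 'd lattice" k] by (simp add: phase_def)
  ultimately have "(LINT x|lborel. (\<Sum>k<N. indicator torus_cube (x :: real ^ 'd) * cos_mean x ^ k)) =
      (2 * pi) ^ CARD('d) * (\<Sum>k<N. walk k (0 :: 'd lattice))"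
    by (simp only: Bochner_Integration.integral_sum sum_distrib_left)
  moreover have "(LINT x|lborel. indicator torus_cube (x :: real ^ 'd) *
      ((\<Sum>k<N. cos_mean x ^ k) / (2 * real CARD('d)))) =
      (LINT x|lborel. (\<Sum>k<N. indicator torus_cube (x :: real ^ 'd) * cos_mean x ^ k)) / (2 * real CARD('d))"
    unfolding integral_divide_zero[symmetric] by (simp only: sum_distrib_left times_divide_eq_right)
  ultimately show ?thesis by (simp add: green_def)
qed

lemma green_tendsto_K_zero:
  assumes "CARD('d::finite) \<ge> 3"
  shows "(\<lambda>N. green N (0 :: 'd lattice)) \<longlonglongrightarrow> K_zero TYPE('d)"
proof -
  define d where "d = real CARD('d)"
  have "d > 0" by (simp add: d_def)
  let ?s = "\<lambda>N (x :: real ^ 'd). indicator torus_cube x * ((\<Sum>k<N. cos_mean x ^ k) / (2 * d))"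
  let ?f = "\<lambda>x :: real ^ 'd. indicator torus_cube x * (1 / symbol x)"
  have [measurable]: "(cos_mean :: real ^ 'd \<Rightarrow> real) \<in> borel_measurable borel"
    by (rule borel_measurable_continuous_onI[OF continuous_cos_mean])
  \<comment> \<open>The closed form of the geometric sum, with 1 - c replaced by the symbol over
    2d.\<close>
  have partial: "(\<Sum>k<N. cos_mean x ^ k) / (2 * d) = (1 - cos_mean x ^ N) * (1 / symbol x)"
    if "symbol x \<noteq> 0" for x :: "real ^ 'd" and N
  proof -
    have "symbol x / (2 * d) * (\<Sum>k<N. cos_mean x ^ k) = 1 - cos_mean x ^ N"
      unfolding one_diff_power_eq one_minus_cos_mean d_def ..
    then show ?thesis using that by (simp add: nonzero_eq_divide_eq mult.commute)
  qed
  have AE_nz: "AE x in lborel. symbol (x :: real ^ 'd) \<noteq> 0 \<and> \<bar>cos_mean x\<bar> < 1"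
    using AE_sin_nonzero[where 'd = 'd]
  proof eventually_elim
    case (elim x)
    then have "\<bar>cos_mean x\<bar> < 1" by (intro abs_cos_mean_less_1) auto
    then show ?case using one_minus_cos_mean[of x] by auto
  qed
  have "(\<lambda>N. LINT x|lborel. ?s N x) \<longlonglongrightarrow> (LINT x|lborel. ?f x)"
  proof (rule integral_dominated_convergence)
    \<comment> \<open>The 2 bounds |1 - c^N|, which can exceed 1 when c is negative and N is
      odd.\<close>
    show "integrable lborel (\<lambda>x. 2 * ?f x)"
      by (intro integrable_mult_right integrable_inverse_symbol assms)
    show "AE x in lborel. (\<lambda>N. ?s N x) \<longlonglongrightarrow> ?f x"
      using AE_nz
    proof eventually_elim
      case (elim x)
      then have "(\<lambda>N. indicator torus_cube x * ((1 - cos_mean x ^ N) * (1 / symbol x)))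
          \<longlonglongrightarrow> indicator torus_cube x * ((1 - 0) * (1 / symbol x))"
        by (intro tendsto_intros LIMSEQ_power_zero) auto
      then show ?case using elim by (simp add: partial)
    qed
    show "AE x in lborel. norm (?s N x) \<le> 2 * ?f x" for N
      using AE_nz
    proof eventually_elim
      case (elim x)
      have "\<bar>cos_mean x ^ N\<bar> \<le> 1"
        unfolding power_abs by (intro power_le_one) (auto simp: abs_cos_mean_le_1)
      then have "\<bar>1 - cos_mean x ^ N\<bar> * (1 / symbol x) \<le> 2 * (1 / symbol x)"
        by (intro mult_right_mono) (auto simp: symbol_nonneg)
      then show ?case using elim symbol_nonneg[of x]
        by (simp add: partial abs_mult indicator_def)
    qed
  qed measurable
  then have "(\<lambda>N. 1 / (2 * pi) ^ CARD('d) * (LINT x|lborel. ?s N x))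
      \<longlonglongrightarrow> 1 / (2 * pi) ^ CARD('d) * (LINT x|lborel. ?f x)"
    by (intro tendsto_intros)
  then show ?thesis
    by (simp add: green_eq_integral K_zero_def symbol_def set_lebesgue_integral_def d_def)
qed

theorem mainTheorem6:
  assumes "CARD('d::finite) \<ge> 3"
  shows "(\<forall>u \<in> l2. (u (0 :: 'd lattice))\<^sup>2 \<le> K_zero TYPE('d) * grad_norm_sq u) \<and>
         (\<forall>C. (\<forall>u \<in> l2. (u (0 :: 'd lattice))\<^sup>2 \<le> C * grad_norm_sq u) \<longrightarrow> K_zero TYPE('d) \<le> C)"
  by (rule sharp_hardy_of_green[OF green_tendsto_K_zero[OF assms]])

end
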